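(* Let $m,p$ be positive integers and $r\in\{0,\ldots,m-1\}$. Let $\overline{\mathcal{T}}=\mathbb{N}\setminus\mathcal{T}$. The minimal automaton of $\mathrm{val}_{2^p}^{-1}(m\overline{\mathcal{T}}+r)$ is obtained by replacing the initial state of the automaton $\mathcal{M}_{m,r,\mathcal{T},2^p}$ (defined in the context) by the state that is reached by reading $\mathrm{rep}_{2^p}(m)$ from the initial state (all states, transitions and the final state being otherwise unchanged).
   Context: Numeration. $A_{2^p}=\{0,\ldots,2^p-1\}$. For $w=c_\ell\cdots c_0\in A_{2^p}^*$, $\mathrm{val}_{2^p}(w)=\sum_j c_j2^{pj}$ (most significant digit first). For $X\subseteq\mathbb{N}$, $\mathrm{val}_{2^p}^{-1}(X)=\{w\in A_{2^p}^*\colon\mathrm{val}_{2^p}(w)\in X\}$ and $mX+r=\{mx+r\colon x\in X\}$. $\mathrm{rep}_{2^p}(n)$ is the usual base-$2^p$ expansion of $n\ge1$ without leading zeroes, and $\mathrm{rep}_{2^p}(0)=\varepsilon$. $\mathcal{T}$ is the set of $n\in\mathbb{N}$ whose binary expansion has an even number of digits $1$. A DFA is minimal iff it is complete, reduced (distinct states accept distinct languages) and accessible. Let $T,B$ be two symbols with $\overline{T}=B$, $\overline{B}=T$. For $X\in\{T,B\}$ and $n\in\mathbb{N}$, $X_n=X$ if $n\in\mathcal{T}$ and $X_n=\overline{X}$ otherwise. Write $m=k2^z$ with $k$ odd, $R=|\mathrm{rep}_{2^p}(r)|$, $N=\max\{\lceil z/p\rceil,R\}$. The automaton $\Pi=\Pi(\mathcal{A}_{m,r,2^p}\times\mathcal{A}_{\mathcal{T},2^p})$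 is the complete DFA over $A_{2^p}$ with state set $\{0,\ldots,m-1\}\times\{T,B\}$, initial state $(0,T)$, unique final state $(r,T)$, and a transition labeled $e\in A_{2^p}$ from $(i,X)$ to $(j,Y)$ iff there exists $d\in A_{2^p}$ with $2^pi+e=md+j$ and $Y=X_d$. Classes. For $\alpha\in\{0,\ldots,N\}$ let \[C_\alpha'=\begin{cases}\{(\lfloor\frac{r}{2^{p\alpha}}\rfloor+\ell\frac{m}{2^{p\alpha}},T_\ell)\colon 0\le\ell\le2^{p\alpha}-1\}&\text{if }\alpha\le\frac zp,\\ \{(\lfloor\frac{r}{2^{p\alpha}}\rfloor+\ell k,T_\ell)\colon 0\le\ell\le2^{z}-1\}&\text{if }\alpha\ge\frac zp,\end{cases}\qquad C_\alpha=C_\alpha'\setminus\bigcup_{\beta=0}^{\alpha-1}C_\beta'.\] For $(j,X)\in(\{0,\ldots,k-1\}\times\{T,B\})\setminus\{(0,T)\}$ let \[D_{(j,X)}'=\{(j+\ell k,X_\ell)\colon 0\le\ell\le 2^z-1\},\qquad D_{(j,X)}=D_{(j,X)}'\setminus\bigcup_{\alpha=0}^{N}C_\alpha.\] The automaton $\mathcal{M}_{m,r,\mathcal{T},2^p}$ over $A_{2^p}$ has as states the classes $C_\alpha$ ($0\le\alpha\le N$) and the nonempty classes $D_{(j,X)}$; its initial state is $C_R$ (which contains $(0,T)$), its only final state is $C_0=\{(r,T)\}$, and there is a transition labeled $a\in A_{2^p}$ from a class $J_1$ to a class $J_2$ iff in $\Pi$ there is a transition labeled $a$ from some state of $J_1$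 to some state of $J_2$. (This is the minimal automaton of $\mathrm{val}_{2^p}^{-1}(m\mathcal{T}+r)$.) *)

theory Defs
  imports Complex_Main "HOL-Computational_Algebra.Primes"
begin

text \<open>Transitions form a relation, since the transitions of a quotient automaton are given as
  one; determinism is required separately.\<close>

record ('q, 'a) automaton =
  states :: "'q set"
  alphabet :: "'a set"
  initial :: 'q
  finals :: "'q set"
  transitions :: "('q \<times> 'a \<times> 'q) set"

primrec reads :: "('q, 'a) automaton \<Rightarrow> 'q \<Rightarrow> 'a list \<Rightarrow> 'q \<Rightarrow> bool" where
  "reads M q [] q' \<longleftrightarrow> q' = q"
| "reads M q (a # w) q' \<longleftrightarrow> (\<exists>s. (q, a, s) \<in> transitions M \<and> reads M s w q')"

definition language_from :: "('q, 'a) automaton \<Rightarrow> 'q \<Rightarrow> 'a list set" where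
  "language_from M q = {w \<in> lists (alphabet M). \<exists>f \<in> finals M. reads M q w f}"

definition language :: "('q, 'a) automaton \<Rightarrow> 'a list set" where
  "language M = language_from M (initial M)"

definition dfa :: "('q, 'a) automaton \<Rightarrow> bool" where
  "dfa M \<longleftrightarrow> finite (states M) \<and> finite (alphabet M) \<and>
     initial M \<in> states M \<and> finals M \<subseteq> states M \<and>
     transitions M \<subseteq> states M \<times> alphabet M \<times> states M \<and>
     (\<forall>q a s s'. (q, a, s) \<in> transitions M \<longrightarrow> (q, a, s') \<in> transitions M \<longrightarrow> s = s')"

definition complete_automaton :: "('q, 'a) automaton \<Rightarrow> bool" where
  "complete_automaton M \<longleftrightarrow>
     (\<forall>q \<in> states M. \<forall>a \<in> alphabet M. \<exists>s \<in> states M. (q, a, s) \<in> transitions M)"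

definition reduced_automaton :: "('q, 'a) automaton \<Rightarrow> bool" where
  "reduced_automaton M \<longleftrightarrow>
     (\<forall>q \<in> states M. \<forall>q' \<in> states M. q \<noteq> q' \<longrightarrow> language_from M q \<noteq> language_from M q')"

definition accessible_automaton :: "('q, 'a) automaton \<Rightarrow> bool" where
  "accessible_automaton M \<longleftrightarrow>
     (\<forall>q \<in> states M. \<exists>w \<in> lists (alphabet M). reads M (initial M) w q)"

definition minimal_dfa :: "('q, 'a) automaton \<Rightarrow> bool" where
  "minimal_dfa M \<longleftrightarrow>
     dfa M \<and> complete_automaton M \<and> reduced_automaton M \<and> accessible_automaton M"

definition minimal_dfa_of :: "('q, 'a) automaton \<Rightarrow> 'a set \<Rightarrow> 'a list set \<Rightarrow> bool" where
  "minimal_dfa_of M A L \<longleftrightarrow> alphabet M = A \<and> minimal_dfa M \<and> language M = L"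

text \<open>Words are written with the most significant digit first.\<close>

definition digits :: "nat \<Rightarrow> nat set" where
  "digits b = {..<b}"

definition val_base :: "nat \<Rightarrow> nat list \<Rightarrow> nat" where
  "val_base b w = (\<Sum>j<length w. rev w ! j * b ^ j)"

text \<open>The guard \<open>b < 2\<close> serves only to make the recursion terminate.\<close>

function rep_base :: "nat \<Rightarrow> nat \<Rightarrow> nat list" where
  "rep_base b n = (if n = 0 \<or> b < 2 then [] else rep_base b (n div b) @ [n mod b])"
  by pat_completeness auto
termination
  by (relation "measure snd") auto

declare rep_base.simps [simp del]

definition val_preimage :: "nat \<Rightarrow> nat set \<Rightarrow> nat list set" where
  "val_preimage b X = {w \<in> lists (digits b). val_base b w \<in> X}"

definition affine_image :: "nat \<Rightarrow> nat set \<Rightarrow> nat \<Rightarrow> nat set" where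
  "affine_image m X r = {m * x + r | x. x \<in> X}"

definition thue_morse :: "nat set" where
  "thue_morse = {n. even (count_list (rep_base 2 n) 1)}"

datatype side = T | B

fun opposite :: "side \<Rightarrow> side" where
  "opposite T = B"
| "opposite B = T"

definition side_at :: "side \<Rightarrow> nat \<Rightarrow> side" where
  "side_at X n = (if n \<in> thue_morse then X else opposite X)"

definition prod_automaton :: "nat \<Rightarrow> nat \<Rightarrow> nat \<Rightarrow> (nat \<times> side, nat) automaton" where
  "prod_automaton m r p = \<lparr>
     states = {..<m} \<times> {T, B},
     alphabet = digits (2 ^ p),
     initial = (0, T),
     finals = {(r, T)},
     transitions = {((i, X), e, (j, Y)) | i X e j Y.
       i < m \<and> j < m \<and> e \<in> digits (2 ^ p) \<and>
       (\<exists>d \<in> digits (2 ^ p). 2 ^ p * i + e = m * d + j \<and> Y = side_at X d)}\<rparr>"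

text \<open>For \<open>m > 0\<close> we have \<open>m = odd_part m * 2 ^ two_exp m\<close> with \<open>odd_part m\<close> odd.\<close>

definition two_exp :: "nat \<Rightarrow> nat" where
  "two_exp m = multiplicity 2 m"

definition odd_part :: "nat \<Rightarrow> nat" where
  "odd_part m = m div 2 ^ two_exp m"

definition rep_length :: "nat \<Rightarrow> nat \<Rightarrow> nat" where
  "rep_length r p = length (rep_base (2 ^ p) r)"

definition max_index :: "nat \<Rightarrow> nat \<Rightarrow> nat \<Rightarrow> nat" where
  "max_index m r p = max (nat \<lceil>real (two_exp m) / real p\<rceil>) (rep_length r p)"

text \<open>If \<open>\<alpha> = two_exp m / p\<close> the two alternatives coincide. In the first one the
  division of \<open>m\<close> is exact.\<close>

definition C_pre :: "nat \<Rightarrow> nat \<Rightarrow> nat \<Rightarrow> nat \<Rightarrow> (nat \<times> side) set" where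
  "C_pre m r p \<alpha> =
     (if real \<alpha> \<le> real (two_exp m) / real p
      then {(r div 2 ^ (p * \<alpha>) + l * (m div 2 ^ (p * \<alpha>)), side_at T l) | l.
              l < 2 ^ (p * \<alpha>)}
      else {(r div 2 ^ (p * \<alpha>) + l * odd_part m, side_at T l) | l.
              l < 2 ^ two_exp m})"

definition C_class :: "nat \<Rightarrow> nat \<Rightarrow> nat \<Rightarrow> nat \<Rightarrow> (nat \<times> side) set" where
  "C_class m r p \<alpha> = C_pre m r p \<alpha> - (\<Union>\<beta><\<alpha>. C_pre m r p \<beta>)"

definition D_index :: "nat \<Rightarrow> (nat \<times> side) set" where
  "D_index m = ({..<odd_part m} \<times> {T, B}) - {(0, T)}"

definition D_pre :: "nat \<Rightarrow> nat \<Rightarrow> side \<Rightarrow> (nat \<times> side) set" where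
  "D_pre m j X = {(j + l * odd_part m, side_at X l) | l. l < 2 ^ two_exp m}"

definition D_class :: "nat \<Rightarrow> nat \<Rightarrow> nat \<Rightarrow> nat \<Rightarrow> side \<Rightarrow> (nat \<times> side) set" where
  "D_class m r p j X = D_pre m j X - (\<Union>\<alpha>\<le>max_index m r p. C_class m r p \<alpha>)"

definition classes :: "nat \<Rightarrow> nat \<Rightarrow> nat \<Rightarrow> (nat \<times> side) set set" where
  "classes m r p =
     {C_class m r p \<alpha> | \<alpha>. \<alpha> \<le> max_index m r p} \<union>
     {D_class m r p j X | j X. (j, X) \<in> D_index m \<and> D_class m r p j X \<noteq> {}}"

definition class_automaton :: "nat \<Rightarrow> nat \<Rightarrow> nat \<Rightarrow> ((nat \<times> side) set, nat) automaton" where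
  "class_automaton m r p = \<lparr>
     states = classes m r p,
     alphabet = digits (2 ^ p),
     initial = C_class m r p (rep_length r p),
     finals = {C_class m r p 0},
     transitions = {(J1, a, J2).
       J1 \<in> classes m r p \<and> a \<in> digits (2 ^ p) \<and> J2 \<in> classes m r p \<and>
       (\<exists>s \<in> J1. \<exists>t \<in> J2. (s, a, t) \<in> transitions (prod_automaton m r p))}\<rparr>"

end

(* Reading a word of length n and value v in the product automaton leads from (i, X) to (j, X_d),
   where 2^(p n) i + v = m d + j. Hence C'_alpha is the set of states accepting the word of length
   alpha and value r mod 2^(p alpha), and every accepted word of length n with p n <= z is of this
   form. On words of length n with p n >= z, the states (j + l k, X_l), l < 2^z, behave alike, and
   their behaviours are pairwise different for different (j, X). So the classes are exactly the
   Nerode classes, which gives the minimal automaton whatever state is made initial (every state is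
   reachable from (0, T) and from (0, B)). Reading the representation of m leads from (0, T) to
   (0, B), and from (0, B) the word w is accepted iff val w = m d + r with d outside thue_morse. *)

theory Submission
  imports Defs
begin

section \<open>Thue-Morse set and sides\<close>

lemma two_mult_thue_morse_iff: "2 * n \<in> thue_morse \<longleftrightarrow> n \<in> thue_morse"
  by (subst (1 2) thue_morse_def) (cases "n = 0", simp_all add: rep_base.simps[of 2 "2 * n"])

lemma Suc_two_mult_thue_morse_iff: "Suc (2 * n) \<in> thue_morse \<longleftrightarrow> n \<notin> thue_morse"
  by (subst (1 2) thue_morse_def) (simp add: rep_base.simps[of 2 "Suc (2 * n)"])

lemma zero_thue_morse: "0 \<in> thue_morse"
  by (simp add: thue_morse_def rep_base.simps[of 2 0])

lemma one_thue_morse: "Suc 0 \<notin> thue_morse"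
  using Suc_two_mult_thue_morse_iff[of 0] zero_thue_morse by simp

text \<open>The binary expansion of the sum is that of \<open>a\<close> followed by that of
  \<open>c\<close>, padded with zeroes to \<open>e\<close> bits, so the parities of the digit sums
  add. The induction strips the last bit.\<close>

lemma thue_morse_append:
  assumes "c < 2 ^ e"
  shows "a * 2 ^ e + c \<in> thue_morse \<longleftrightarrow> (a \<in> thue_morse \<longleftrightarrow> c \<in> thue_morse)"
  using assms
proof (induction e arbitrary: c)
  case 0
  then show ?case by (simp add: zero_thue_morse)
next
  case (Suc e)
  define h where "h = c div 2"
  have h: "h < 2 ^ e" using Suc.prems by (simp add: h_def)
  have "c = 2 * h \<or> c = Suc (2 * h)" by (auto simp: h_def)
  then show ?case
  proof
    assume c: "c = 2 * h"
    have "a * 2 ^ Suc e + c = 2 * (a * 2 ^ e + h)" by (simp add: c)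
    then show ?thesis using Suc.IH[OF h] c by (simp only: two_mult_thue_morse_iff)
  next
    assume c: "c = Suc (2 * h)"
    have "a * 2 ^ Suc e + c = Suc (2 * (a * 2 ^ e + h))" by (simp add: c)
    then show ?thesis using Suc.IH[OF h] c by (simp only: Suc_two_mult_thue_morse_iff) blast
  qed
qed

lemma thue_morse_times_power: "a * 2 ^ e \<in> thue_morse \<longleftrightarrow> a \<in> thue_morse"
  using thue_morse_append[of 0 e a] by (simp add: zero_thue_morse)

lemma opposite_opposite: "opposite (opposite X) = X"
  by (cases X) auto

lemma side_at_side_at: "side_at (side_at X n) n = X"
  by (auto simp: side_at_def opposite_opposite)

text \<open>This is what makes runs compose: the quotient produced by a longer word is the
  concatenation of the quotients of its pieces.\<close>

lemma side_at_append:
  "c < 2 ^ e \<Longrightarrow> side_at (side_at X a) c = side_at X (a * 2 ^ e + c)"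
  by (auto simp: side_at_def opposite_opposite thue_morse_append)

lemma side_at_zero: "side_at X 0 = X"
  by (simp add: side_at_def zero_thue_morse)

lemma side_at_inject: "side_at X n = side_at Y n \<longleftrightarrow> X = Y"
  by (metis side_at_side_at)

section \<open>Values and representations of words\<close>

lemma val_base_Nil: "val_base b [] = 0"
  by (simp add: val_base_def)

lemma val_base_Cons: "val_base b (a # w) = a * b ^ length w + val_base b w"
  by (simp add: val_base_def nth_append)

lemma val_base_snoc: "val_base b (w @ [a]) = val_base b w * b + a"
  by (induction w) (simp_all add: val_base_Nil val_base_Cons algebra_simps)

lemma val_base_less: "w \<in> lists (digits b) \<Longrightarrow> val_base b w < b ^ length w"
proof (induction w)
  case Nil
  then show ?case by (simp add: val_base_Nil)
next
  case (Cons a w)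
  then have "val_base b w < b ^ length w" "Suc a \<le> b" by (auto simp: digits_def)
  moreover have "Suc a * b ^ length w \<le> b * b ^ length w"
    using \<open>Suc a \<le> b\<close> by (intro mult_right_mono) auto
  ultimately show ?case by (simp add: val_base_Cons)
qed

text \<open>Leading zeroes are allowed, so the length can be prescribed. The test words that
  separate states are obtained this way.\<close>

lemma ex_word_val_base:
  assumes "v < b ^ n"
  obtains w where "w \<in> lists (digits b)" "length w = n" "val_base b w = v"
proof -
  have "\<exists>w. w \<in> lists (digits b) \<and> length w = n \<and> val_base b w = v"
    using assms
  proof (induction n arbitrary: v)
    case 0
    then show ?case by (simp add: val_base_Nil)
  next
    case (Suc n)
    have b: "0 < b" using Suc.prems by (cases b) auto
    have "v div b < b ^ n" using Suc.prems b by (simp add: less_mult_imp_div_less mult.commute)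
    with Suc.IH obtain w where "w \<in> lists (digits b)" "length w = n" "val_base b w = v div b"
      by blast
    then show ?case
      using b by (intro exI[of _ "w @ [v mod b]"]) (auto simp: val_base_snoc digits_def)
  qed
  then show thesis using that by blast
qed

lemma rep_base_correct:
  assumes "2 \<le> b"
  shows "rep_base b n \<in> lists (digits b) \<and> val_base b (rep_base b n) = n"
proof (induction n rule: less_induct)
  case (less n)
  show ?case
  proof (cases "n = 0")
    case True
    then show ?thesis by (simp add: rep_base.simps[of b 0] val_base_Nil)
  next
    case False
    then have "n div b < n" using assms by simp
    from less.IH[OF this] show ?thesis
      using False assms by (subst (1 2) rep_base.simps) (simp add: val_base_snoc digits_def)
  qed
qed

text \<open>Representations have no leading zeroes. Together with
  \<open>less_power_length_rep_base\<close> this locates the first exponent at which the quotient of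
  \<open>r\<close> vanishes.\<close>

lemma power_length_rep_base_le:
  assumes "2 \<le> b" "i < length (rep_base b n)"
  shows "b ^ i \<le> n"
  using assms(2)
proof (induction n arbitrary: i rule: less_induct)
  case (less n)
  have n: "n \<noteq> 0" using less.prems by (intro notI) (simp add: rep_base.simps[of b 0])
  then have len: "length (rep_base b n) = Suc (length (rep_base b (n div b)))"
    using assms(1) by (subst rep_base.simps) simp
  show ?case
  proof (cases i)
    case 0
    then show ?thesis using n by simp
  next
    case (Suc i')
    have "n div b < n" using n assms(1) by simp
    from less.IH[OF this, of i'] have "b ^ i' \<le> n div b" using less.prems len Suc by simp
    then have "b ^ i' * b \<le> n div b * b" by simp
    also have "\<dots> \<le> n" by simp
    finally show ?thesis using Suc by (simp add: mult.commute)
  qed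
qed

lemma less_power_length_rep_base: "2 \<le> b \<Longrightarrow> n < b ^ length (rep_base b n)"
  using rep_base_correct[of b n] val_base_less[of "rep_base b n" b] by simp

section \<open>Runs of the product automaton\<close>

text \<open>The state of the product automaton reached from \<open>s\<close> by reading \<open>w\<close>.\<close>

definition run :: "nat \<Rightarrow> nat \<Rightarrow> nat \<times> side \<Rightarrow> nat list \<Rightarrow> nat \<times> side" where
  "run b m s w = (let u = b ^ length w * fst s + val_base b w
     in (u mod m, side_at (snd s) (u div m)))"

text \<open>In long division by \<open>m\<close> a remainder below \<open>m\<close> is carried over,
  hence reading a block of values below \<open>c\<close> produces a quotient block below
  \<open>c\<close>.\<close>

lemma div_less_of_state:
  fixes i m c v :: nat
  assumes "i < m" "v < c"
  shows "(c * i + v) div m < c"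
proof -
  have "c * i + v < c * Suc i" using assms(2) by simp
  also have "\<dots> \<le> c * m" using assms(1) by (intro mult_left_mono) auto
  finally show ?thesis by (rule less_mult_imp_div_less)
qed

lemma fst_run_less: "0 < m \<Longrightarrow> fst (run b m s w) < m"
  by (simp add: run_def Let_def)

lemma run_Nil: "fst s < m \<Longrightarrow> run b m s [] = s"
  by (cases s) (simp add: run_def Let_def val_base_Nil side_at_zero)

text \<open>Long division done in two stages: the total quotient is \<open>d * c\<close> plus the
  quotient of the second stage, which is below \<open>c\<close>, so the two blocks do not overlap in
  binary.\<close>

lemma run_Cons:
  assumes "fst s < m" "w \<in> lists (digits (2 ^ p))"
  shows "run (2 ^ p) m s (a # w) = run (2 ^ p) m (run (2 ^ p) m s [a]) w"
proof -
  obtain i X where s: "s = (i, X)" by (cases s)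
  define c where "c = (2::nat) ^ (p * length w)"
  define d where "d = (2 ^ p * i + a) div m"
  define j where "j = (2 ^ p * i + a) mod m"
  define v where "v = val_base (2 ^ p) w"
  have m: "0 < m" using assms(1) by simp
  have c: "(2 ^ p) ^ length w = c" by (simp add: c_def power_mult)
  have "v < c" using val_base_less[OF assms(2)] by (simp add: v_def c)
  moreover have "j < m" using m by (simp add: j_def)
  ultimately have less: "(c * j + v) div m < c" by (intro div_less_of_state)
  have dj: "2 ^ p * i + a = d * m + j" by (simp add: d_def j_def)
  have "(2 ^ p) ^ length (a # w) * i + val_base (2 ^ p) (a # w) = c * (2 ^ p * i + a) + v"
    by (simp add: val_base_Cons c v_def algebra_simps)
  also have "\<dots> = (d * c) * m + (c * j + v)" unfolding dj by (simp add: algebra_simps)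
  finally have u: "(2 ^ p) ^ length (a # w) * i + val_base (2 ^ p) (a # w) =
    (d * c) * m + (c * j + v)" .
  have "run (2 ^ p) m s (a # w) =
      ((c * j + v) mod m, side_at X (d * c + (c * j + v) div m))"
    unfolding run_def Let_def s fst_conv snd_conv u using m by simp
  moreover have "run (2 ^ p) m s [a] = (j, side_at X d)"
    by (simp add: run_def Let_def s val_base_Cons val_base_Nil d_def j_def)
  ultimately show ?thesis
    using less by (simp add: run_def Let_def c v_def side_at_append c_def)
qed

text \<open>The witness \<open>d\<close> is forced to be the quotient by \<open>m\<close>, which is
  a digit by \<open>div_less_of_state\<close>. So the transition relation is the graph of a total
  function.\<close>

lemma prod_automaton_transition_iff:
  assumes "0 < m"
  shows "(s, a, t) \<in> transitions (prod_automaton m r p) \<longleftrightarrow>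
    fst s < m \<and> a \<in> digits (2 ^ p) \<and> t = run (2 ^ p) m s [a]"
proof -
  obtain i X where s: "s = (i, X)" by (cases s)
  obtain j Y where t: "t = (j, Y)" by (cases t)
  have eq: "(\<exists>d \<in> digits (2 ^ p). 2 ^ p * i + a = m * d + j \<and> Y = side_at X d) \<longleftrightarrow>
      j = (2 ^ p * i + a) mod m \<and> Y = side_at X ((2 ^ p * i + a) div m)"
    if "i < m" "j < m" "a < 2 ^ p"
  proof
    assume "\<exists>d \<in> digits (2 ^ p). 2 ^ p * i + a = m * d + j \<and> Y = side_at X d"
    then show "j = (2 ^ p * i + a) mod m \<and> Y = side_at X ((2 ^ p * i + a) div m)"
      using that by auto
  next
    assume "j = (2 ^ p * i + a) mod m \<and> Y = side_at X ((2 ^ p * i + a) div m)"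
    then show "\<exists>d \<in> digits (2 ^ p). 2 ^ p * i + a = m * d + j \<and> Y = side_at X d"
      using that
      by (intro bexI[of _ "(2 ^ p * i + a) div m"]) (auto simp: digits_def div_less_of_state)
  qed
  have run: "run (2 ^ p) m s [a] = ((2 ^ p * i + a) mod m, side_at X ((2 ^ p * i + a) div m))"
    by (simp add: run_def Let_def s val_base_Cons val_base_Nil)
  show ?thesis
    unfolding run using eq assms by (auto simp: prod_automaton_def s t digits_def)
qed

section \<open>Fibres over residues\<close>

text \<open>Both kinds of classes are built from sets of this shape: \<open>e = z\<close> gives the sets indexed by
  \<open>D\<close>, and \<open>e = min z (p * \<alpha>)\<close> unifies the two cases in the definition of those indexed by \<open>C\<close>.\<close>

definition fibre :: "nat \<Rightarrow> nat \<Rightarrow> nat \<Rightarrow> side \<Rightarrow> (nat \<times> side) set" where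
  "fibre m e j X = {(j + l * (m div 2 ^ e), side_at X l) | l. l < 2 ^ e}"

text \<open>Here \<open>l\<close> and \<open>j\<close> are quotient and remainder of
  \<open>i\<close> by \<open>m div 2 ^ e\<close>, and \<open>l < 2 ^ e\<close> amounts to
  \<open>i < m\<close>. In this form fibres of different moduli can be compared.\<close>

lemma mem_fibre_iff:
  assumes "0 < m" "2 ^ e dvd m" "j < m div 2 ^ e"
  shows "(i, Y) \<in> fibre m e j X \<longleftrightarrow>
    i < m \<and> i mod (m div 2 ^ e) = j \<and> Y = side_at X (i div (m div 2 ^ e))"
proof -
  define q where "q = m div 2 ^ e"
  have m: "m = 2 ^ e * q" using assms(2) by (simp add: q_def)
  have q: "0 < q" using assms(1) m by simp
  have jq: "j < q" using assms(3) by (simp add: q_def)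
  have less: "j + l * q < m \<longleftrightarrow> l < 2 ^ e" for l
  proof -
    have "j + l * q < m \<longleftrightarrow> (j + l * q) div q < 2 ^ e"
      unfolding m by (simp only: div_less_iff_less_mult[OF q])
    then show ?thesis using q jq by simp
  qed
  show ?thesis
    unfolding fibre_def q_def[symmetric]
  proof (intro iffI)
    assume "(i, Y) \<in> {(j + l * q, side_at X l) | l. l < 2 ^ e}"
    then obtain l where "l < 2 ^ e" "i = j + l * q" "Y = side_at X l" by blast
    then show "i < m \<and> i mod q = j \<and> Y = side_at X (i div q)"
      using less[of l] jq by simp
  next
    assume a: "i < m \<and> i mod q = j \<and> Y = side_at X (i div q)"
    then have eq: "j + (i div q) * q = i" by (metis add.commute div_mult_mod_eq)
    then have "i div q < 2 ^ e" using less[of "i div q"] a by simp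
    moreover have "(i, Y) = (j + (i div q) * q, side_at X (i div q))" using eq a by simp
    ultimately show "(i, Y) \<in> {(j + l * q, side_at X l) | l. l < 2 ^ e}" by blast
  qed
qed

text \<open>Adding \<open>l * (m div 2 ^ e)\<close> to the starting point adds \<open>l * 2 ^ (p * n - e)\<close> to the quotient
  by \<open>m\<close>, and the resulting factor \<open>side_at X l\<close> is cancelled by the second component.\<close>

lemma run_fibre:
  assumes "0 < m" "2 ^ e dvd m" "j < m div 2 ^ e" "s \<in> fibre m e j X"
    and "w \<in> lists (digits (2 ^ p))" "e \<le> p * length w"
  shows "run (2 ^ p) m s w = run (2 ^ p) m (j, X) w"
proof -
  define q where "q = m div 2 ^ e"
  define f where "f = p * length w - e"
  define v where "v = val_base (2 ^ p) w"
  define c where "c = (2::nat) ^ (p * length w)"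
  obtain l where s: "s = (j + l * q, side_at X l)" using assms(4) by (auto simp: fibre_def q_def)
  have m: "m = 2 ^ e * q" using assms(2) by (simp add: q_def)
  have c: "(2 ^ p) ^ length w = c" by (simp add: c_def power_mult)
  have cf: "c = 2 ^ f * 2 ^ e"
    using assms(6) by (simp add: c_def f_def flip: power_add)
  have v: "v < c" using val_base_less[OF assms(5)] by (simp add: v_def c)
  have "(c * j + v) div q < c"
    using assms(3) v by (intro div_less_of_state) (simp_all add: q_def)
  \<comment> \<open>The quotient has to fit into \<open>f\<close> bits, below the shifted
    \<open>l\<close>, for the parities to add.\<close>
  then have "(c * j + v) div q div 2 ^ e < 2 ^ f"
    by (simp add: cf less_mult_imp_div_less)
  then have less: "(c * j + v) div m < 2 ^ f"
    by (simp add: m mult.commute div_mult2_eq)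
  have u: "c * (j + l * q) + v = (l * 2 ^ f) * m + (c * j + v)"
    by (simp add: cf m algebra_simps)
  have "run (2 ^ p) m s w = ((c * j + v) mod m,
      side_at (side_at X l) (l * 2 ^ f + (c * j + v) div m))"
    unfolding run_def Let_def s fst_conv snd_conv c v_def[symmetric] u using assms(1) by simp
  also have "\<dots> = ((c * j + v) mod m, side_at X ((c * j + v) div m))"
    by (simp add: side_at_append[OF less, symmetric] side_at_side_at)
  finally show ?thesis by (simp add: run_def Let_def c v_def)
qed

section \<open>The sets behind the classes as fibres\<close>

locale thue_morse_affine =
  fixes m p r :: nat
  assumes m_pos: "0 < m" and p_pos: "0 < p" and r_less: "r < m"
begin

abbreviation "k \<equiv> odd_part m"
abbreviation "z \<equiv> two_exp m"
abbreviation "N \<equiv> max_index m r p"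
abbreviation "words \<equiv> lists (digits (2 ^ p))"
abbreviation "rn \<equiv> run (2 ^ p) m"
abbreviation "depth \<alpha> \<equiv> min z (p * \<alpha>)"

lemma power_dvd: "e \<le> z \<Longrightarrow> 2 ^ e dvd m"
  unfolding two_exp_def by (rule multiplicity_dvd')

lemma m_eq: "m = 2 ^ z * k"
  using power_dvd[of z] by (simp add: odd_part_def)

lemma odd_k: "odd k"
  using multiplicity_decompose[of m 2] m_pos by (simp add: odd_part_def two_exp_def)

lemma k_pos: "0 < k"
  using odd_k by (cases k) auto

lemma base_ge_2: "2 \<le> (2::nat) ^ p"
  using p_pos by (metis One_nat_def Suc_leI power_increasing power_one_right one_le_numeral)

lemma C_pre_eq: "C_pre m r p \<alpha> = fibre m (depth \<alpha>) (r div 2 ^ (p * \<alpha>)) T"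
proof -
  have "real \<alpha> \<le> real z / real p \<longleftrightarrow> real (p * \<alpha>) \<le> real z"
    using p_pos by (simp add: pos_le_divide_eq mult.commute)
  then have "real \<alpha> \<le> real z / real p \<longleftrightarrow> p * \<alpha> \<le> z" by (metis of_nat_le_iff)
  then show ?thesis
    by (auto simp: C_pre_def fibre_def odd_part_def min_def)
qed

lemma D_pre_eq: "D_pre m j X = fibre m z j X"
  by (simp add: D_pre_def fibre_def odd_part_def)

lemma power_depth_dvd: "2 ^ depth \<alpha> dvd m"
  by (rule power_dvd) simp

lemma m_eq_depth: "m = 2 ^ depth \<alpha> * (m div 2 ^ depth \<alpha>)"
  using power_depth_dvd by simp

text \<open>This makes the quotient of \<open>r\<close> a genuine remainder for the modulus at
  \<alpha>. When \<open>p * \<alpha>\<close> exceeds \<open>z\<close>, the larger divisor only makes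
  it smaller.\<close>

lemma r_div_less: "r div 2 ^ (p * \<alpha>) < m div 2 ^ depth \<alpha>"
proof -
  have "r div 2 ^ (p * \<alpha>) \<le> r div 2 ^ depth \<alpha>"
    by (intro div_le_mono2 power_increasing) auto
  also have "\<dots> < m div 2 ^ depth \<alpha>"
    using m_eq_depth[of \<alpha>] r_less by (metis less_mult_imp_div_less mult.commute)
  finally show ?thesis .
qed

lemma mem_C_pre_iff:
  "(i, Y) \<in> C_pre m r p \<alpha> \<longleftrightarrow> i < m \<and> i mod (m div 2 ^ depth \<alpha>) = r div 2 ^ (p * \<alpha>) \<and>
    Y = side_at T (i div (m div 2 ^ depth \<alpha>))"
  unfolding C_pre_eq by (rule mem_fibre_iff[OF m_pos power_depth_dvd r_div_less])

lemma mem_D_pre_iff: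
  assumes "j < k"
  shows "(i, Y) \<in> D_pre m j X \<longleftrightarrow> i < m \<and> i mod k = j \<and> Y = side_at X (i div k)"
  using mem_fibre_iff[OF m_pos power_dvd[of z], of j i Y X] assms
  by (simp add: D_pre_eq odd_part_def)

lemma run_C_pre:
  assumes "s \<in> C_pre m r p \<alpha>" "w \<in> words" "depth \<alpha> \<le> p * length w"
  shows "rn s w = rn (r div 2 ^ (p * \<alpha>), T) w"
  using run_fibre[OF m_pos power_depth_dvd[of \<alpha>] r_div_less[of \<alpha>]] assms
  by (simp add: C_pre_eq)

lemma run_D_pre:
  assumes "j < k" "s \<in> D_pre m j X" "w \<in> words" "z \<le> p * length w"
  shows "rn s w = rn (j, X) w"
  using run_fibre[OF m_pos power_dvd[of z]] assms by (simp add: D_pre_eq odd_part_def)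

section \<open>Accepted words\<close>

lemma power_base: "((2::nat) ^ p) ^ n = 2 ^ (p * n)"
  by (simp add: power_mult)

lemma run_eq_final_iff:
  "rn (i, X) w = (r, T) \<longleftrightarrow>
    (\<exists>d. 2 ^ (p * length w) * i + val_base (2 ^ p) w = m * d + r \<and> side_at X d = T)"
  (is "_ \<longleftrightarrow> (\<exists>d. ?u = _ \<and> _)")
proof
  assume "rn (i, X) w = (r, T)"
  then have "?u mod m = r" "side_at X (?u div m) = T"
    by (simp_all add: run_def Let_def power_base)
  then show "\<exists>d. ?u = m * d + r \<and> side_at X d = T"
    by (intro exI[of _ "?u div m"]) auto
next
  assume "\<exists>d. ?u = m * d + r \<and> side_at X d = T"
  then show "rn (i, X) w = (r, T)"
    using r_less by (auto simp: run_def Let_def power_base)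
qed

text \<open>From \<open>(r div 2 ^ (p * length w), T)\<close> the number read is exactly
  \<open>r\<close>, with quotient 0; the other elements of the fibre behave alike on words of this
  length.\<close>

lemma C_pre_accepts:
  assumes "s \<in> C_pre m r p (length w)" "w \<in> words"
    and "val_base (2 ^ p) w = r mod 2 ^ (p * length w)"
  shows "rn s w = (r, T)"
proof -
  have "rn (r div 2 ^ (p * length w), T) w = (r, T)"
    unfolding run_eq_final_iff using assms(3) by (intro exI[of _ 0]) (simp add: side_at_zero)
  then show ?thesis using run_C_pre[OF assms(1,2)] by simp
qed

text \<open>Subtracting the equation for \<open>r\<close> and cancelling \<open>2 ^ e\<close> leaves
  \<open>2 ^ f * i = q * d + 2 ^ f * g\<close>. Then \<open>2 ^ f\<close> divides \<open>d\<close>,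
  and the cofactor \<open>l\<close> is the index in the fibre; trailing zero bits do not affect the
  side.\<close>

lemma C_pre_of_accepts:
  assumes "fst s < m" "w \<in> words" "rn s w = (r, T)"
    and "val_base (2 ^ p) w = r mod 2 ^ (p * length w)"
  shows "s \<in> C_pre m r p (length w)"
proof -
  obtain i X where s: "s = (i, X)" by (cases s)
  define n where "n = length w"
  define e where "e = depth n"
  define q where "q = m div 2 ^ e"
  define g where "g = r div 2 ^ (p * n)"
  define f where "f = p * n - e"
  obtain d where d: "2 ^ (p * n) * i + val_base (2 ^ p) w = m * d + r" "side_at X d = T"
    using assms(3) unfolding s run_eq_final_iff n_def by blast
  have r: "r = 2 ^ (p * n) * g + val_base (2 ^ p) w"
    using assms(4) by (simp add: g_def n_def)
  have pn: "(2::nat) ^ (p * n) = 2 ^ e * 2 ^ f" by (simp add: e_def f_def flip: power_add)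
  have m: "m = 2 ^ e * q" using m_eq_depth[of n] by (simp add: e_def q_def)
  have "2 ^ e * (2 ^ f * i) = 2 ^ (p * n) * i" by (simp add: pn)
  also have "\<dots> = m * d + 2 ^ (p * n) * g" using d(1) r by linarith
  also have "\<dots> = 2 ^ e * (q * d + 2 ^ f * g)"
    unfolding pn by (subst m) (simp add: algebra_simps)
  finally have "2 ^ e * (2 ^ f * i) = 2 ^ e * (q * d + 2 ^ f * g)" .
  then have i: "2 ^ f * i = q * d + 2 ^ f * g" by simp
  then have "2 ^ f dvd q * d" by (metis dvd_add_left_iff dvd_triv_left)
  \<comment> \<open>Either the word is short and \<open>f = 0\<close>, or all factors 2 of
    \<open>m\<close> are cancelled and \<open>q = k\<close> is odd.\<close>
  moreover have "coprime (2 ^ f) q"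
  proof (cases "p * n \<le> z")
    case True
    then show ?thesis by (simp add: f_def e_def)
  next
    case False
    then have "q = k" by (simp add: q_def e_def odd_part_def)
    then show ?thesis using odd_k by simp
  qed
  ultimately have "2 ^ f dvd d" by (simp add: coprime_dvd_mult_right_iff)
  then obtain l where l: "d = l * 2 ^ f" by (metis dvd_def mult.commute)
  from i have "2 ^ f * i = 2 ^ f * (g + l * q)" by (simp add: l algebra_simps)
  then have i: "i = g + l * q" by simp
  have X: "X = side_at T l"
    using d(2) side_at_side_at[of X d] by (simp add: l side_at_def thue_morse_times_power)
  have "g < q" using r_div_less[of n] by (simp add: g_def q_def e_def)
  then show ?thesis
    using assms(1) X i unfolding s n_def[symmetric] mem_C_pre_iff
    by (simp add: e_def[symmetric] q_def[symmetric] g_def[symmetric])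
qed

text \<open>Modulo \<open>2 ^ (p * n)\<close> with \<open>p * n \<le> z\<close>, all numbers \<open>m * d + r\<close> are congruent to \<open>r\<close>.\<close>

lemma short_accepted_word:
  assumes "fst s < m" "w \<in> words" "rn s w = (r, T)" "p * length w \<le> z"
  shows "s \<in> C_pre m r p (length w)"
proof -
  obtain i X where s: "s = (i, X)" by (cases s)
  let ?c = "(2::nat) ^ (p * length w)" and ?v = "val_base (2 ^ p) w"
  obtain d where d: "?c * i + ?v = m * d + r"
    using assms(3) unfolding s run_eq_final_iff by blast
  have "?c dvd m" using power_dvd assms(4) by blast
  then have "(m * d + r) mod ?c = r mod ?c" by (metis dvd_mult2 dvd_imp_mod_0 mod_add_left_eq add_0)
  moreover have "(?c * i + ?v) mod ?c = ?v"
    using val_base_less[OF assms(2)] by (simp add: power_base)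
  ultimately have "?v = r mod ?c" using d by simp
  then show ?thesis using C_pre_of_accepts assms by blast
qed

text \<open>A long word can realise several consecutive quotients, among which both sides
  occur.\<close>

lemma ex_long_accepted_word:
  assumes "fst s < m"
  obtains w where "w \<in> words" "z \<le> p * length w" "rn s w = (r, T)"
proof -
  obtain i X where s: "s = (i, X)" by (cases s)
  \<comment> \<open>This length gives \<open>c\<close> at least \<open>4 * m\<close>, and
    \<open>z \<le> p * n\<close> because \<open>2 ^ z \<le> m\<close>.\<close>
  define n where "n = m + 2"
  define c where "c = (2::nat) ^ (p * n)"
  define e where "e = c * i div m"
  \<comment> \<open>The least even number above \<open>e\<close>: an even number and its successor
    lie on different sides, and both are at most \<open>e + 3\<close>.\<close>
  define d where "d = 2 * Suc (e div 2)"
  have "2 ^ z \<le> m" using power_dvd[of z] m_pos by (intro dvd_imp_le) auto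
  then have "z < m" using less_exp[of z] by linarith
  moreover have "1 * n \<le> p * n" using p_pos by (intro mult_right_mono) auto
  ultimately have z: "z \<le> p * n" by (simp add: n_def)
  have "4 * m \<le> 4 * 2 ^ m" using less_exp[of m] by simp
  also have "\<dots> = 2 ^ n" by (simp add: n_def)
  also have "\<dots> \<le> c" unfolding c_def using \<open>1 * n \<le> p * n\<close> by (intro power_increasing) auto
  finally have c: "4 * m \<le> c" .
  have "d \<in> thue_morse \<longleftrightarrow> Suc d \<notin> thue_morse"
    unfolding d_def two_mult_thue_morse_iff Suc_two_mult_thue_morse_iff by simp
  then have "side_at X d = T \<or> side_at X (Suc d) = T"
    by (cases X) (auto simp: side_at_def)
  then obtain d' where d': "d' = d \<or> d' = Suc d" "side_at X d' = T" by blast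
  then have "Suc e \<le> d'" "Suc d' \<le> e + 4" by (auto simp: d_def)
  have "c * i < m * Suc e" using m_pos by (simp add: e_def dividend_less_times_div)
  also have "\<dots> \<le> m * d'" using \<open>Suc e \<le> d'\<close> by (rule mult_le_mono2)
  finally have lower: "c * i \<le> m * d' + r" by simp
  have "m * d' + r < m * Suc d'" using r_less by simp
  also have "\<dots> \<le> m * (e + 4)" using \<open>Suc d' \<le> e + 4\<close> by (rule mult_le_mono2)
  also have "\<dots> \<le> c * i + c" 
    using c times_div_less_eq_dividend[of m "c * i"] unfolding e_def distrib_left by linarith
  finally have "m * d' + r - c * i < (2 ^ p) ^ n" using lower by (simp add: power_base c_def)
  then obtain w where w: "w \<in> words" "length w = n" "val_base (2 ^ p) w = m * d' + r - c * i"
    by (rule ex_word_val_base)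
  have "rn s w = (r, T)"
    unfolding s run_eq_final_iff
    using d' lower w by (intro exI[of _ d']) (simp add: c_def[symmetric])
  then show thesis using that w z by blast
qed

text \<open>The difference of the two equations is divisible by \<open>k\<close>, which is coprime
  to powers of 2; so \<open>j\<close> and \<open>j'\<close> are congruent modulo \<open>k\<close>,
  hence equal. Then the quotients agree, and so do the sides.\<close>

lemma accepted_word_determines_index:
  assumes "j < k" "j' < k" "rn (j, X) w = (r, T)" "rn (j', X') w = (r, T)"
  shows "j = j' \<and> X = X'"
proof -
  let ?c = "2 ^ (p * length w)" and ?v = "val_base (2 ^ p) w"
  obtain d where d: "?c * j + ?v = m * d + r" "side_at X d = T"
    using assms(3) unfolding run_eq_final_iff by blast
  obtain d' where d': "?c * j' + ?v = m * d' + r" "side_at X' d' = T"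
    using assms(4) unfolding run_eq_final_iff by blast
  have "int ?c * int j + int ?v = int m * int d + int r"
    using arg_cong[OF d(1), of int] by (simp only: of_nat_add of_nat_mult)
  moreover have "int ?c * int j' + int ?v = int m * int d' + int r"
    using arg_cong[OF d'(1), of int] by (simp only: of_nat_add of_nat_mult)
  ultimately have "int ?c * (int j - int j') = int m * (int d - int d')"
    by (simp add: algebra_simps)
  moreover have "int k dvd int m" by (subst m_eq) simp
  ultimately have "int k dvd int ?c * (int j - int j')" by simp
  moreover have "coprime (int k) (int ?c)" using odd_k by simp
  ultimately have "int k dvd int j - int j'" by (simp add: coprime_dvd_mult_right_iff)
  then have j: "j = j'"
    using assms(1,2) dvd_imp_le_int[of "int j - int j'" "int k"] by (cases "j = j'") auto
  then have "d = d'" using d d' m_pos by simp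
  then show ?thesis using j d d' by (metis side_at_inject)
qed

section \<open>The bound N and nonemptiness of the C classes\<close>

lemma z_le_p_N: "z \<le> p * N"
proof -
  have "real z / real p \<le> real (nat \<lceil>real z / real p\<rceil>)" by linarith
  also have "\<dots> \<le> real N" by (simp add: max_index_def)
  finally have "real z \<le> real (p * N)" using p_pos by (simp add: field_simps)
  then show ?thesis by linarith
qed

lemma rep_length_le_N: "rep_length r p \<le> N"
  by (simp add: max_index_def)

text \<open>Such an \<alpha> can only come from the ceiling of \<open>z / p\<close> in the maximum
  defining \<open>N\<close>.\<close>

lemma le_N_cases:
  assumes "\<alpha> \<le> N" "rep_length r p < \<alpha>" "\<beta> < \<alpha>"
  shows "p * \<beta> < z"
proof -
  have "\<alpha> \<le> nat \<lceil>real z / real p\<rceil>" using assms by (auto simp: max_index_def)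
  then have "real \<beta> < real z / real p" using assms(3) by linarith
  then have "real (p * \<beta>) < real z" using p_pos by (simp add: field_simps)
  then show ?thesis by linarith
qed

lemma r_div_eq_0: "rep_length r p \<le> \<alpha> \<Longrightarrow> r div 2 ^ (p * \<alpha>) = 0"
proof -
  assume "rep_length r p \<le> \<alpha>"
  then have "(2::nat) ^ (p * rep_length r p) \<le> 2 ^ (p * \<alpha>)"
    by (intro power_increasing mult_left_mono) auto
  moreover have "r < 2 ^ (p * rep_length r p)"
    using less_power_length_rep_base[OF base_ge_2, of r] by (simp add: rep_length_def power_base)
  ultimately have "r < 2 ^ (p * \<alpha>)" by linarith
  then show ?thesis by simp
qed

text \<open>Before the length of \<open>r\<close> is reached the quotient is still positive, and a
  further division by at least 2 decreases it.\<close>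

lemma r_div_strict:
  assumes "\<beta> < \<alpha>" "\<beta> < rep_length r p"
  shows "r div 2 ^ (p * \<alpha>) < r div 2 ^ (p * \<beta>)"
proof -
  have "(2 ^ p) ^ \<beta> \<le> r"
    using power_length_rep_base_le[OF base_ge_2] assms(2) by (simp add: rep_length_def)
  then have pos: "0 < r div 2 ^ (p * \<beta>)" by (simp add: power_base div_greater_zero_iff)
  have "p * \<alpha> = p * \<beta> + p * (\<alpha> - \<beta>)" using assms(1) by (simp flip: distrib_left)
  then have "r div 2 ^ (p * \<alpha>) = r div 2 ^ (p * \<beta>) div 2 ^ (p * (\<alpha> - \<beta>))"
    by (simp add: power_add div_mult2_eq)
  moreover have "1 < (2::nat) ^ (p * (\<alpha> - \<beta>))" using p_pos assms(1) by (intro one_less_power) auto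
  then have "r div 2 ^ (p * \<beta>) div 2 ^ (p * (\<alpha> - \<beta>)) < r div 2 ^ (p * \<beta>)"
    using pos by (rule div_less_dividend)
  ultimately show ?thesis by simp
qed

lemma div_depth_mono: "\<beta> \<le> \<alpha> \<Longrightarrow> m div 2 ^ depth \<alpha> \<le> m div 2 ^ depth \<beta>"
  by (intro div_le_mono2 power_increasing) (auto simp: min_le_iff_disj)

text \<open>Moduli do not increase with the index, so this number is its own residue for every
  earlier modulus, and by \<open>r_div_strict\<close> it is not the residue required there.\<close>

lemma mem_C_class_of_le_rep_length:
  assumes "\<alpha> \<le> rep_length r p"
  shows "(r div 2 ^ (p * \<alpha>), T) \<in> C_class m r p \<alpha>"
proof -
  let ?g = "\<lambda>\<alpha>. r div 2 ^ (p * \<alpha>)"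
  have "?g \<alpha> < m div 2 ^ depth \<beta>" if "\<beta> < \<alpha>" for \<beta>
    using r_div_less[of \<alpha>] div_depth_mono[of \<beta> \<alpha>] that by linarith
  then have "(?g \<alpha>, T) \<notin> C_pre m r p \<beta>" if "\<beta> < \<alpha>" for \<beta>
    using that r_div_strict[of \<beta> \<alpha>] assms by (simp add: mem_C_pre_iff)
  moreover have "?g \<alpha> \<le> r" by simp
  then have "?g \<alpha> < m" using r_less by linarith
  then have "(?g \<alpha>, T) \<in> C_pre m r p \<alpha>"
    using r_div_less[of \<alpha>] by (simp add: mem_C_pre_iff side_at_zero)
  ultimately show ?thesis by (auto simp: C_class_def)
qed

text \<open>Past the length of \<open>r\<close>, the element with index \<open>l = 1\<close> is new.\<close>

lemma C_class_nonempty: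
  assumes "\<alpha> \<le> N"
  shows "C_class m r p \<alpha> \<noteq> {}"
proof (cases "\<alpha> \<le> rep_length r p")
  case True
  then show ?thesis using mem_C_class_of_le_rep_length by blast
next
  case False
  define q where "q = m div 2 ^ depth \<alpha>"
  have side: "side_at T 1 = B" by (simp add: side_at_def one_thue_morse)
  have q: "0 < q" using r_div_less[of \<alpha>] by (simp add: q_def)
  have lt: "q < m div 2 ^ depth \<beta>" if "\<beta> < \<alpha>" for \<beta>
  proof -
    have "p * \<beta> < z" using le_N_cases assms False that by simp
    moreover have "p * \<beta> < p * \<alpha>" using that p_pos by simp
    ultimately have less: "depth \<beta> < depth \<alpha>" by simp
    have "2 ^ depth \<alpha> * q = 2 ^ depth \<beta> * (m div 2 ^ depth \<beta>)"
      using m_eq_depth[of \<alpha>] m_eq_depth[of \<beta>] by (simp add: q_def)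
    moreover have "2 ^ depth \<beta> * q < 2 ^ depth \<alpha> * q"
      using less q by (intro mult_strict_right_mono power_strict_increasing) auto
    ultimately have "2 ^ depth \<beta> * q < 2 ^ depth \<beta> * (m div 2 ^ depth \<beta>)" by (rule subst)
    then show ?thesis by (simp only: mult_less_cancel1)
  qed
  have "q < m" using lt[of 0] False by simp
  then have "(q, B) \<in> C_pre m r p \<alpha>"
    using r_div_eq_0[of \<alpha>] False side q by (simp add: mem_C_pre_iff q_def[symmetric])
  \<comment> \<open>For the larger modulus at \<beta> the quotient of \<open>q\<close> is 0, which
    would force side \<open>T\<close>.\<close>
  moreover have "(q, B) \<notin> C_pre m r p \<beta>" if "\<beta> < \<alpha>" for \<beta>
    using lt[OF that] by (simp add: mem_C_pre_iff side_at_zero)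
  ultimately show ?thesis by (auto simp: C_class_def)
qed

section \<open>The classes cover the state set\<close>

lemma UN_C_class: "(\<Union>\<alpha>\<le>n. C_class m r p \<alpha>) = (\<Union>\<alpha>\<le>n. C_pre m r p \<alpha>)"
proof
  show "(\<Union>\<alpha>\<le>n. C_class m r p \<alpha>) \<subseteq> (\<Union>\<alpha>\<le>n. C_pre m r p \<alpha>)"
    by (auto simp: C_class_def)
next
  show "(\<Union>\<alpha>\<le>n. C_pre m r p \<alpha>) \<subseteq> (\<Union>\<alpha>\<le>n. C_class m r p \<alpha>)"
  proof
    fix s assume "s \<in> (\<Union>\<alpha>\<le>n. C_pre m r p \<alpha>)"
    then obtain \<alpha> where \<alpha>: "\<alpha> \<le> n" "s \<in> C_pre m r p \<alpha>" by blast
    define \<beta> where "\<beta> = (LEAST \<beta>. s \<in> C_pre m r p \<beta>)"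
    have "s \<in> C_pre m r p \<beta>" "\<beta> \<le> \<alpha>" "\<forall>\<gamma><\<beta>. s \<notin> C_pre m r p \<gamma>"
      unfolding \<beta>_def using \<alpha>(2) by (auto intro: LeastI Least_le dest: not_less_Least)
    then show "s \<in> (\<Union>\<alpha>\<le>n. C_class m r p \<alpha>)"
      using \<alpha>(1) by (auto simp: C_class_def)
  qed
qed

lemma classes_cases:
  assumes "J \<in> classes m r p"
  obtains (C) \<alpha> where "\<alpha> \<le> N" "J = C_class m r p \<alpha>"
  | (D) j X where "j < k" "J = D_class m r p j X"
  using assms by (auto simp: classes_def D_index_def)

lemma not_C_pre_of_D_class:
  "s \<in> D_class m r p j X \<Longrightarrow> n \<le> N \<Longrightarrow> s \<notin> C_pre m r p n"
  unfolding D_class_def UN_C_class by auto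

lemma C_class_D: "s \<in> C_class m r p \<alpha> \<Longrightarrow> s \<in> C_pre m r p \<alpha>"
  "s \<in> C_class m r p \<alpha> \<Longrightarrow> \<beta> < \<alpha> \<Longrightarrow> s \<notin> C_pre m r p \<beta>"
  by (auto simp: C_class_def)

lemma fst_less_of_class:
  assumes "J \<in> classes m r p" "s \<in> J"
  shows "fst s < m"
  using assms(1)
proof (cases rule: classes_cases)
  case (C \<alpha>)
  then show ?thesis using assms(2) by (cases s) (auto dest!: C_class_D(1) simp: mem_C_pre_iff)
next
  case (D j X)
  then have "s \<in> D_pre m j X" using assms(2) by (simp add: D_class_def)
  then show ?thesis using D(1) by (cases s) (simp add: mem_D_pre_iff)
qed

lemma classes_cover:
  assumes "fst s < m"
  shows "\<exists>J \<in> classes m r p. s \<in> J"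
proof (cases "s \<in> (\<Union>\<alpha>\<le>N. C_class m r p \<alpha>)")
  case True
  then show ?thesis by (auto simp: classes_def)
next
  case False
  obtain i X where s: "s = (i, X)" by (cases s)
  define Y where "Y = side_at X (i div k)"
  have k: "i mod k < k" using k_pos by simp
  have mem: "s \<in> D_pre m (i mod k) Y"
    using assms k by (simp add: s mem_D_pre_iff Y_def side_at_side_at)
  \<comment> \<open>This is why \<open>(0, T)\<close> is excluded from \<open>D_index\<close>: a
    state outside all C classes never has that index.\<close>
  have "D_pre m 0 T = C_pre m r p N"
    using z_le_p_N r_div_eq_0[OF rep_length_le_N] by (simp add: D_pre_eq C_pre_eq)
  moreover have "s \<notin> C_pre m r p N" using False unfolding UN_C_class by blast
  ultimately have "(i mod k, Y) \<noteq> (0, T)" using mem by auto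
  then have "(i mod k, Y) \<in> D_index m"
    using k by (cases Y) (auto simp: D_index_def)
  moreover have "s \<in> D_class m r p (i mod k) Y" using mem False by (simp add: D_class_def)
  ultimately show ?thesis
    by (intro bexI[of _ "D_class m r p (i mod k) Y"]) (auto simp: classes_def)
qed

section \<open>Classes and Nerode equivalence\<close>

definition equivalent :: "nat \<times> side \<Rightarrow> nat \<times> side \<Rightarrow> bool" where
  "equivalent s t \<longleftrightarrow> (\<forall>w \<in> words. rn s w = (r, T) \<longleftrightarrow> rn t w = (r, T))"

text \<open>Long words do not distinguish elements of one fibre. A short word accepted from either
  state would put that state into a C set which its class avoids, so it is rejected from
  both.\<close>

lemma equivalent_of_same_class:
  assumes "J \<in> classes m r p" "s \<in> J" "t \<in> J"
  shows "equivalent s t"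
  unfolding equivalent_def
proof
  fix w assume w: "w \<in> words"
  note lt = fst_less_of_class[OF assms(1,2)] fst_less_of_class[OF assms(1,3)]
  show "rn s w = (r, T) \<longleftrightarrow> rn t w = (r, T)"
    using assms(1)
  proof (cases rule: classes_cases)
    case (C \<alpha>)
    note s = C_class_D[OF assms(2)[unfolded C]] and t = C_class_D[OF assms(3)[unfolded C]]
    show ?thesis
    proof (cases "depth \<alpha> \<le> p * length w")
      case True
      then show ?thesis using run_C_pre[OF s(1) w] run_C_pre[OF t(1) w] by simp
    next
      case False
      then have "p * length w \<le> z" "p * length w < p * \<alpha>" by linarith+
      then have "p * length w \<le> z" "length w < \<alpha>" by simp_all
      then show ?thesis
        using short_accepted_word[OF lt(1) w] short_accepted_word[OF lt(2) w] s(2) t(2) by blast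
    qed
  next
    case (D j X)
    have pre: "s \<in> D_pre m j X" "t \<in> D_pre m j X" using assms(2,3) D by (auto simp: D_class_def)
    show ?thesis
    proof (cases "z \<le> p * length w")
      case True
      then show ?thesis using run_D_pre[OF D(1) _ w] pre by metis
    next
      case False
      have "p * length w < p * N" using False z_le_p_N by linarith
      then have "length w \<le> N" by simp
      then show ?thesis
        using short_accepted_word[OF lt(1) w] short_accepted_word[OF lt(2) w] False
          not_C_pre_of_D_class assms(2,3) D by (meson nat_le_linear)
    qed
  qed
qed

text \<open>The word of length \<alpha> and value \<open>r mod 2 ^ (p * \<alpha>)\<close> is
  accepted exactly from this set.\<close>

lemma equivalent_C_pre:
  assumes "equivalent s t" "fst t < m" "s \<in> C_pre m r p \<alpha>"
  shows "t \<in> C_pre m r p \<alpha>"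
proof -
  have "r mod 2 ^ (p * \<alpha>) < (2 ^ p) ^ \<alpha>" by (simp add: power_base)
  then obtain w where w: "w \<in> words" "length w = \<alpha>" "val_base (2 ^ p) w = r mod 2 ^ (p * \<alpha>)"
    by (rule ex_word_val_base)
  then have "rn s w = (r, T)" using C_pre_accepts assms(3) by blast
  then have "rn t w = (r, T)" using assms(1) w by (auto simp: equivalent_def)
  then show ?thesis using C_pre_of_accepts assms(2) w by blast
qed

lemma equivalent_sym: "equivalent s t \<Longrightarrow> equivalent t s"
  by (auto simp: equivalent_def)

text \<open>The index of a C class is the least \<alpha> whose C set contains the state, and
  equivalent states lie in the same C sets.\<close>

lemma class_of_equivalent_C:
  assumes "\<alpha> \<le> N" "s \<in> C_class m r p \<alpha>" "J \<in> classes m r p" "t \<in> J" "equivalent s t"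
  shows "J = C_class m r p \<alpha>"
proof -
  have "C_class m r p \<alpha> \<in> classes m r p" using assms(1) by (auto simp: classes_def)
  then have lt: "fst s < m" "fst t < m" using fst_less_of_class assms by blast+
  have iff: "s \<in> C_pre m r p \<beta> \<longleftrightarrow> t \<in> C_pre m r p \<beta>" for \<beta>
    using equivalent_C_pre assms(5) lt equivalent_sym by blast
  note s = C_class_D[OF assms(2)]
  from assms(3) show ?thesis
  proof (cases rule: classes_cases)
    case (C \<beta>)
    have "\<alpha> = \<beta>"
      using s iff C_class_D[OF assms(4)[unfolded C]] by (metis linorder_neqE_nat)
    then show ?thesis using C by simp
  next
    case (D j X)
    then show ?thesis using not_C_pre_of_D_class assms(1,4) s(1) iff by blast
  qed
qed

text \<open>For two D classes, one long word accepted from both states already determines the index.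
  Taking \<open>s = t\<close> gives disjointness of distinct classes.\<close>

lemma same_class_of_equivalent:
  assumes "J \<in> classes m r p" "J' \<in> classes m r p" "s \<in> J" "t \<in> J'" "equivalent s t"
  shows "J = J'"
  using assms(1)
proof (cases rule: classes_cases)
  case (C \<alpha>)
  then show ?thesis using class_of_equivalent_C assms by blast
next
  case J: (D j X)
  from assms(2) show ?thesis
  proof (cases rule: classes_cases)
    case (C \<alpha>)
    then show ?thesis using class_of_equivalent_C assms equivalent_sym by blast
  next
    case J': (D j' X')
    obtain w where w: "w \<in> words" "z \<le> p * length w" "rn s w = (r, T)"
      using ex_long_accepted_word fst_less_of_class[OF assms(1,3)] by blast
    then have "rn t w = (r, T)" using assms(5) by (auto simp: equivalent_def)
    moreover have "s \<in> D_pre m j X" "t \<in> D_pre m j' X'"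
      using assms(3,4) J J' by (auto simp: D_class_def)
    ultimately have "rn (j, X) w = (r, T)" "rn (j', X') w = (r, T)"
      using w run_D_pre J(1) J'(1) by metis+
    then show ?thesis using accepted_word_determines_index J J' by blast
  qed
qed

lemma class_closed_equivalent:
  assumes "J \<in> classes m r p" "s \<in> J" "fst t < m" "equivalent s t"
  shows "t \<in> J"
  using same_class_of_equivalent classes_cover assms by blast

section \<open>Runs of the class automaton\<close>

lemma class_nonempty: "J \<in> classes m r p \<Longrightarrow> J \<noteq> {}"
  using C_class_nonempty by (auto simp: classes_def)

lemma C_0: "C_class m r p 0 = {(r, T)}"
  by (auto simp: C_class_def C_pre_def side_at_zero)

text \<open>Transitions are defined through some representative; any fixed one will do, since
  equivalence is preserved by reading a letter and classes are closed under it.\<close>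

lemma class_transition_iff:
  assumes "J \<in> classes m r p" "s \<in> J"
  shows "(J, a, J') \<in> transitions (class_automaton m r p) \<longleftrightarrow>
    a \<in> digits (2 ^ p) \<and> J' \<in> classes m r p \<and> rn s [a] \<in> J'"
proof
  assume "(J, a, J') \<in> transitions (class_automaton m r p)"
  then obtain s0 where a: "a \<in> digits (2 ^ p)" and J': "J' \<in> classes m r p"
    and s0: "s0 \<in> J" "rn s0 [a] \<in> J'"
    by (auto simp: class_automaton_def prod_automaton_transition_iff[OF m_pos])
  have "equivalent (rn s0 [a]) (rn s [a])"
    unfolding equivalent_def
  proof
    fix w assume w: "w \<in> words"
    have "equivalent s0 s" using equivalent_of_same_class assms s0 by blast
    then have "rn s0 (a # w) = (r, T) \<longleftrightarrow> rn s (a # w) = (r, T)"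
      using a w by (simp add: equivalent_def)
    then show "rn (rn s0 [a]) w = (r, T) \<longleftrightarrow> rn (rn s [a]) w = (r, T)"
      using run_Cons w fst_less_of_class assms s0 by metis
  qed
  then show "a \<in> digits (2 ^ p) \<and> J' \<in> classes m r p \<and> rn s [a] \<in> J'"
    using a J' s0 class_closed_equivalent fst_run_less[OF m_pos] by blast
next
  assume "a \<in> digits (2 ^ p) \<and> J' \<in> classes m r p \<and> rn s [a] \<in> J'"
  then show "(J, a, J') \<in> transitions (class_automaton m r p)"
    using assms fst_less_of_class[OF assms]
    by (auto simp: class_automaton_def prod_automaton_transition_iff[OF m_pos])
qed

lemma reads_class_iff:
  assumes "w \<in> words" "J \<in> classes m r p" "s \<in> J"
  shows "reads (class_automaton m r p) J w J' \<longleftrightarrow> J' \<in> classes m r p \<and> rn s w \<in> J'"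
  using assms(2,3,1)
proof (induction w arbitrary: J s)
  case Nil
  have "equivalent s s" by (simp add: equivalent_def)
  then show ?case
    using Nil run_Nil[OF fst_less_of_class[OF Nil(1,2)]] same_class_of_equivalent[of J' J s s] by auto
next
  case (Cons a w)
  then have a: "a \<in> digits (2 ^ p)" and w: "w \<in> words" by auto
  obtain S where S: "S \<in> classes m r p" "rn s [a] \<in> S"
    using classes_cover fst_run_less[OF m_pos] by blast
  have "reads (class_automaton m r p) J (a # w) J' \<longleftrightarrow>
      (\<exists>S. S \<in> classes m r p \<and> rn s [a] \<in> S \<and> reads (class_automaton m r p) S w J')"
    using class_transition_iff[OF Cons.prems(1,2)] a by auto
  also have "\<dots> \<longleftrightarrow> J' \<in> classes m r p \<and> rn (rn s [a]) w \<in> J'"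
    using Cons.IH S w by blast
  finally show ?case
    using run_Cons[OF fst_less_of_class[OF Cons.prems(1,2)] w] by simp
qed

section \<open>Minimality and language after changing the initial state\<close>

lemma reads_initial_update: "reads (M\<lparr>initial := q\<rparr>) J w J' \<longleftrightarrow> reads M J w J'"
  by (induction w arbitrary: J) auto

lemma language_from_class:
  assumes "J \<in> classes m r p" "s \<in> J"
  shows "language_from (class_automaton m r p\<lparr>initial := q\<rparr>) J =
    {w \<in> words. rn s w = (r, T)}"
proof -
  have "{(r, T)} \<in> classes m r p" unfolding C_0[symmetric] by (auto simp: classes_def)
  moreover have "alphabet (class_automaton m r p\<lparr>initial := q\<rparr>) = digits (2 ^ p)"
    "finals (class_automaton m r p\<lparr>initial := q\<rparr>) = {{(r, T)}}"
    by (simp_all add: class_automaton_def C_0)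
  ultimately show ?thesis
    using reads_class_iff[OF _ assms, of _ "{(r, T)}"]
    by (auto simp: language_from_def reads_initial_update)
qed

text \<open>Only accessibility depends on the initial class, and there a state with first component
  0 suffices, whatever its side.\<close>

lemma minimal_dfa_class_automaton:
  assumes "q \<in> classes m r p" "(0, X) \<in> q"
  shows "minimal_dfa (class_automaton m r p\<lparr>initial := q\<rparr>)" (is "minimal_dfa ?M")
proof -
  have fields: "states ?M = classes m r p" "alphabet ?M = digits (2 ^ p)" "initial ?M = q"
    "finals ?M = {C_class m r p 0}" "transitions ?M = transitions (class_automaton m r p)"
    by (simp_all add: class_automaton_def)
  have "classes m r p \<subseteq> Pow ({..<m} \<times> {T, B})"
  proof
    fix J assume "J \<in> classes m r p"
    then have "\<forall>s \<in> J. fst s < m" using fst_less_of_class by blast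
    then show "J \<in> Pow ({..<m} \<times> {T, B})" using side.exhaust by auto
  qed
  then have fin: "finite (classes m r p)" by (rule finite_subset) simp
  have "S = S'" if "(J, a, S) \<in> transitions (class_automaton m r p)"
    "(J, a, S') \<in> transitions (class_automaton m r p)" for J a S S'
  proof -
    have J: "J \<in> classes m r p" using that by (auto simp: class_automaton_def)
    then obtain s where "s \<in> J" using class_nonempty by blast
    then have "S \<in> classes m r p" "S' \<in> classes m r p" "rn s [a] \<in> S" "rn s [a] \<in> S'"
      using that J class_transition_iff by blast+
    then show ?thesis using same_class_of_equivalent by (auto simp: equivalent_def)
  qed
  then have det: "\<forall>J a S S'. (J, a, S) \<in> transitions (class_automaton m r p) \<longrightarrow>
      (J, a, S') \<in> transitions (class_automaton m r p) \<longrightarrow> S = S'"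
    by blast
  have "transitions (class_automaton m r p) \<subseteq>
      classes m r p \<times> digits (2 ^ p) \<times> classes m r p"
    by (auto simp: class_automaton_def)
  moreover have "C_class m r p 0 \<in> classes m r p" by (auto simp: classes_def)
  ultimately have "dfa ?M"
    unfolding dfa_def fields using fin assms(1) det by (simp add: digits_def)
  moreover have "complete_automaton ?M"
    unfolding complete_automaton_def fields
  proof (intro ballI)
    fix J a assume J: "J \<in> classes m r p" and a: "a \<in> digits (2 ^ p)"
    obtain s where s: "s \<in> J" using class_nonempty[OF J] by blast
    obtain S where "S \<in> classes m r p" "rn s [a] \<in> S"
      using classes_cover fst_run_less[OF m_pos] by blast
    then show "\<exists>S \<in> classes m r p. (J, a, S) \<in> transitions (class_automaton m r p)"
      using class_transition_iff[OF J s] a by blast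
  qed
  moreover have "reduced_automaton ?M"
    unfolding reduced_automaton_def fields
  proof (intro ballI impI notI)
    fix J J' assume J: "J \<in> classes m r p" and J': "J' \<in> classes m r p" and ne: "J \<noteq> J'"
      and eq: "language_from ?M J = language_from ?M J'"
    obtain s t where st: "s \<in> J" "t \<in> J'" using class_nonempty J J' by blast
    then have "equivalent s t"
      using eq language_from_class[OF J st(1)] language_from_class[OF J' st(2)]
      unfolding equivalent_def by blast
    then show False using same_class_of_equivalent J J' st ne by blast
  qed
  moreover have "accessible_automaton ?M"
    unfolding accessible_automaton_def fields reads_initial_update
  proof
    fix J assume J: "J \<in> classes m r p"
    obtain j Y where s: "(j, Y) \<in> J" using class_nonempty[OF J] by fastforce
    have j: "j < m" using fst_less_of_class[OF J s] by simp
    \<comment> \<open>Quotient 0 keeps the side and quotient 1 switches it, so reading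
      \<open>m * d + j\<close> leads from \<open>(0, X)\<close> to \<open>(j, Y)\<close>.\<close>
    define d :: nat where "d = (if X = Y then 0 else 1)"
    have d: "side_at X d = Y"
      by (cases X; cases Y) (auto simp: d_def side_at_def zero_thue_morse one_thue_morse)
    define w where "w = rep_base (2 ^ p) (m * d + j)"
    have w: "w \<in> words" "val_base (2 ^ p) w = m * d + j"
      using rep_base_correct[OF base_ge_2] by (simp_all add: w_def)
    then have "rn (0, X) w = (j, Y)" using j d by (simp add: run_def Let_def)
    then show "\<exists>w \<in> words. reads (class_automaton m r p) q w J"
      using reads_class_iff[OF w(1) assms] J s w(1) by auto
  qed
  ultimately show ?thesis by (simp add: minimal_dfa_def)
qed

lemma language_class_of_zero_B:
  assumes "q \<in> classes m r p" "(0, B) \<in> q"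
  shows "language (class_automaton m r p\<lparr>initial := q\<rparr>) =
    val_preimage (2 ^ p) (affine_image m (- thue_morse) r)"
proof -
  have "rn (0, B) w = (r, T) \<longleftrightarrow> val_base (2 ^ p) w \<in> affine_image m (- thue_morse) r" for w
    unfolding run_eq_final_iff affine_image_def by (auto simp: side_at_def)
  then show ?thesis
    using language_from_class[OF assms] by (simp add: language_def val_preimage_def)
qed

text \<open>Since \<open>m = m * 1 + 0\<close> and 1 is not in \<open>thue_morse\<close>, the run
  returns to remainder 0 on the other side. Uniqueness of \<open>q\<close> comes from disjointness
  of the classes.\<close>

lemma class_reached_by_rep_m:
  "\<exists>q. q \<in> classes m r p \<and> (0, B) \<in> q \<and>
    (\<forall>q'. reads (class_automaton m r p) (initial (class_automaton m r p))
      (rep_base (2 ^ p) m) q' \<longleftrightarrow> q' = q)"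
proof -
  let ?w = "rep_base (2 ^ p) m"
  have w: "?w \<in> words" "val_base (2 ^ p) ?w = m" using rep_base_correct[OF base_ge_2] by auto
  have run: "rn (0, T) ?w = (0, B)"
    using m_pos w by (simp add: run_def Let_def side_at_def one_thue_morse)
  obtain q where q: "q \<in> classes m r p" "(0, B) \<in> q"
    using classes_cover[of "(0, B)"] m_pos by auto
  have "(0, T) \<in> C_class m r p (rep_length r p)"
    using mem_C_class_of_le_rep_length[of "rep_length r p"] by (simp add: r_div_eq_0)
  moreover have "C_class m r p (rep_length r p) \<in> classes m r p"
    using rep_length_le_N by (auto simp: classes_def)
  moreover have "q' \<in> classes m r p \<and> (0, B) \<in> q' \<longleftrightarrow> q' = q" for q'
    using q same_class_of_equivalent[of q' q "(0, B)" "(0, B)"] by (auto simp: equivalent_def)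
  ultimately have "reads (class_automaton m r p) (C_class m r p (rep_length r p)) ?w q' \<longleftrightarrow>
      q' = q" for q'
    using reads_class_iff[OF w(1)] run by metis
  then show ?thesis using q by (intro exI[of _ q]) (simp add: class_automaton_def)
qed

end

theorem proposition51:
  fixes m p r :: nat
  assumes "0 < m" and "0 < p" and "r < m"
  shows "\<exists>q. (\<forall>q'. reads (class_automaton m r p) (initial (class_automaton m r p))
                       (rep_base (2 ^ p) m) q' \<longleftrightarrow> q' = q) \<and>
             minimal_dfa_of (class_automaton m r p \<lparr>initial := q\<rparr>) (digits (2 ^ p))
               (val_preimage (2 ^ p) (affine_image m (- thue_morse) r))"
proof -
  interpret thue_morse_affine m p r using assms by unfold_locales
  obtain q where q: "q \<in> classes m r p" "(0, B) \<in> q"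
    and reads: "\<forall>q'. reads (class_automaton m r p) (initial (class_automaton m r p))
      (rep_base (2 ^ p) m) q' \<longleftrightarrow> q' = q"
    using class_reached_by_rep_m by blast
  have "alphabet (class_automaton m r p\<lparr>initial := q\<rparr>) = digits (2 ^ p)"
    by (simp add: class_automaton_def)
  then have "minimal_dfa_of (class_automaton m r p\<lparr>initial := q\<rparr>) (digits (2 ^ p))
      (val_preimage (2 ^ p) (affine_image m (- thue_morse) r))"
    using minimal_dfa_class_automaton[OF q] language_class_of_zero_B[OF q]
    by (simp add: minimal_dfa_of_def)
  with reads show ?thesis by blast
qed

end
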